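(* Let $c>0$ and $0<m<4c/e$, and let $\Phi_c(x)=\frac{x}{\pi^2}\ln\frac{4\pi^2c}{x}$ for $x>0$. Then the equation $m=\Phi_c(x)$ has exactly one solution $x$ in $(0,4\pi^2c/e)$, namely $$x=-\frac{\pi^2m}{W_{-1}\bigl(-m/(4c)\bigr)}.$$
   Context: $W_{-1}$ is the real branch of the Lambert $W$ function (satisfying $W(y)e^{W(y)}=y$) with $W_{-1}(y)\le-1$ for $-1/e<y<0$. $\ln$ is the natural logarithm. *)

theory Defs
  imports Complex_Main
begin

text \<open>
  Real branch \<open>W\<^sub>-\<^sub>1\<close> of the Lambert function: the solution \<open>w \<le> -1\<close> of \<open>w e\<^sup>w = y\<close>.
  It is only meant for \<open>-1/e < y < 0\<close>, where this solution exists and is unique;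
  the value is arbitrary elsewhere when there is no such solution.
\<close>
definition lambert_Wm1 :: "real \<Rightarrow> real" where
  "lambert_Wm1 y = (THE w. w \<le> -1 \<and> w * exp w = y)"

text \<open>Only meant for \<open>x > 0\<close> (and \<open>c > 0\<close>).\<close>
definition Phi :: "real \<Rightarrow> real \<Rightarrow> real" where
  "Phi c x = x / pi^2 * ln (4 * pi^2 * c / x)"

end

theory Submission
  imports Defs
begin

text \<open>
  Substituting \<open>x = 4 \<pi>\<^sup>2 c e\<^sup>w\<close> turns \<open>m = \<Phi>\<^sub>c x\<close> into \<open>w e\<^sup>w = - m / (4 c)\<close>, and \<open>x < 4 \<pi>\<^sup>2 c / e\<close>
  into \<open>w < -1\<close>; so \<open>w\<close> has to be the value of \<open>W\<^sub>-\<^sub>1\<close> at \<open>- m / (4 c)\<close>, and then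
  \<open>x = 4 \<pi>\<^sup>2 c e\<^sup>w = - \<pi>\<^sup>2 m / w\<close>.
\<close>

text \<open>The map strictly decreases here: for \<open>v < w\<close>, multiplying
  \<open>1 + (w - v) < exp (w - v)\<close> by the negative \<open>w\<close> and using
  \<open>w \<le> -1\<close> yields \<open>w * exp (w - v) < v\<close>.\<close>

lemma inj_on_mult_exp: "inj_on (\<lambda>w::real. w * exp w) {..-1}"
proof (rule linorder_inj_onI)
  fix v w :: real
  assume "v < w" and "w \<in> {..-1}"
  hence w: "w \<le> -1" by simp
  have "1 + (w - v) < exp (w - v)"
    using \<open>v < w\<close> exp_minus_greater[of "v - w"] by simp
  hence "w * exp (w - v) < w * (1 + (w - v))"
    using w by (intro mult_strict_left_mono_neg) auto
  also have "\<dots> \<le> v"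
  proof -
    \<comment> \<open>The product equals \<open>v - w * (1 + (w - v))\<close>.\<close>
    have "0 \<le> (w - v) * (-1 - w)"
      using \<open>v < w\<close> w by (intro mult_nonneg_nonneg) auto
    thus ?thesis by (simp add: algebra_simps)
  qed
  finally have "w * exp (w - v) * exp v < v * exp v" by simp
  thus "v * exp v \<noteq> w * exp w" by (simp add: exp_diff)
qed auto

text \<open>Intermediate values on \<open>[-t, -1]\<close>: at \<open>-1\<close> the function is
  \<open>- 1 / exp 1\<close>, below \<open>y\<close>; far to the left it is close to 0, hence above
  \<open>y\<close>.\<close>

lemma ex_mult_exp_eq:
  fixes y :: real
  assumes "- 1 / exp 1 < y" and "y < 0"
  shows "\<exists>w\<le>-1. w * exp w = y"
proof -
  \<comment> \<open>Chosen so that \<open>t^2 / 2 \<le> exp t\<close> becomes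
    \<open>t * exp (- t) \<le> 2 / t = - y\<close>.\<close>
  define t where "t = - 2 / y"
  have "1 < exp (1::real)" by simp
  hence "1 / exp 1 < (1::real)" by simp
  with assms have "-1 < y" by linarith
  hence t: "t > 1" using assms by (simp add: t_def field_simps)
  have "t\<^sup>2 / 2 \<le> exp t"
    using exp_lower_Taylor_quadratic[of t] t by simp
  hence "t * exp (- t) \<le> 2 / t"
    using t by (simp add: exp_minus field_simps power2_eq_square)
  also have "2 / t = - y" using assms by (simp add: t_def)
  finally have upper: "y \<le> - t * exp (- t)" by simp
  have lower: "-1 * exp (-1) \<le> y"
    using assms by (simp add: exp_minus field_simps)
  have "\<exists>w\<ge>- t. w \<le> -1 \<and> w * exp w = y"
    using upper lower t by (intro IVT2') (auto intro!: continuous_intros)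
  thus ?thesis by blast
qed

lemma lambert_Wm1_eqI:
  assumes "w \<le> -1" and "w * exp w = y"
  shows "lambert_Wm1 y = w"
  unfolding lambert_Wm1_def
  using assms by (intro the_equality) (auto dest: inj_onD[OF inj_on_mult_exp])

lemma Phi_exp:
  assumes "c > 0"
  shows "Phi c (4 * pi^2 * c * exp w) = - (4 * c) * (w * exp w)"
proof -
  have "4 * pi^2 * c / (4 * pi^2 * c * exp w) = exp (- w)"
    using assms by (simp add: exp_minus field_simps)
  thus ?thesis by (simp add: Phi_def)
qed

theorem lemma1p7:
  fixes c m :: real
  assumes "c > 0" and "0 < m" and "m < 4 * c / exp 1"
  shows "(\<exists>!x. x \<in> {0<..<4 * pi^2 * c / exp 1} \<and> m = Phi c x) \<and>
         - (pi^2 * m / lambert_Wm1 (- m / (4 * c))) \<in> {0<..<4 * pi^2 * c / exp 1} \<and>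
         m = Phi c (- (pi^2 * m / lambert_Wm1 (- m / (4 * c))))"
proof -
  define y where "y = - m / (4 * c)"
  have y: "- 1 / exp 1 < y" "y < 0"
    using assms by (auto simp: y_def field_simps)
  obtain w where w: "w \<le> -1" "w * exp w = y"
    using ex_mult_exp_eq[OF y] by blast
  \<comment> \<open>\<open>w = -1\<close> would force \<open>y = - 1 / exp 1\<close>, against the
    strict bound on \<open>m\<close>. Strictness is what keeps \<open>x\<close> off the right end of
    the open interval.\<close>
  have "w \<noteq> -1"
    using w y by (auto simp: exp_minus field_simps)
  with w have w_less: "w < -1" by simp
  have W: "lambert_Wm1 y = w"
    using w by (rule lambert_Wm1_eqI)
  define x where "x = 4 * pi^2 * c * exp w"
  have "m = - 4 * c * (w * exp w)"
    using w assms by (simp add: y_def)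
  hence x_eq: "- (pi^2 * m / w) = x"
    using w_less by (simp add: x_def)
  have range_iff: "4 * pi^2 * c * exp v < 4 * pi^2 * c / exp 1 \<longleftrightarrow> v < -1" for v
  proof -
    have "4 * pi^2 * c / exp 1 = 4 * pi^2 * c * exp (-1)"
      by (simp add: exp_minus field_simps)
    thus ?thesis using assms by simp
  qed
  have Phi_iff: "m = Phi c (4 * pi^2 * c * exp v) \<longleftrightarrow> v * exp v = y" for v
    unfolding Phi_exp[OF assms(1)] y_def using assms(1) by (auto simp: field_simps)
  have x: "x \<in> {0<..<4 * pi^2 * c / exp 1}" "m = Phi c x"
    using range_iff w_less assms Phi_iff w by (auto simp: x_def)
  have "z = x" if z: "z \<in> {0<..<4 * pi^2 * c / exp 1}" "m = Phi c z" for z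
  proof -
    \<comment> \<open>The substitution inverted, possible since \<open>z > 0\<close>: uniqueness of
      \<open>z\<close> reduces to that of the Lambert value.\<close>
    define v where "v = ln (z / (4 * pi^2 * c))"
    have z_eq: "z = 4 * pi^2 * c * exp v"
      using z assms by (simp add: v_def)
    have "v < -1" "v * exp v = y"
      using z range_iff Phi_iff by (auto simp: z_eq)
    hence "v = w"
      using lambert_Wm1_eqI[of v y] W by simp
    thus "z = x" by (simp add: z_eq x_def)
  qed
  with x show ?thesis
    unfolding y_def[symmetric] W x_eq by blast
qed

end
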